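(* Let $f \in L^2(\mathbb{S}^1)$ satisfy $f' \in L^2(\mathbb{S}^1)$ and $\int_{0}^{2\pi} f(\theta)\, d\theta = 0$. Then $$\int_{0}^{2\pi} (1-\cos\theta)\,|f'(\theta)|^2\, d\theta \;\ge\; \frac18 \int_0^{2\pi} |f(\theta)|^2\, d\theta .$$ Furthermore, the constant $1/8$ is sharp (it cannot be replaced by a larger constant).
   Context: A function $f$ on the unit circle $\mathbb{S}^1$ is identified with the $2\pi$-periodic function $f(\theta) = f(e^{i\theta})$, $\theta\in[0,2\pi)$; $f'$ is the (distributional/periodic) derivative $df/d\theta$, i.e. the Fourier coefficients of $f'$ are $in\,\widehat f_n$, where $\widehat f_n=\frac1{2\pi}\int_0^{2\pi} f(t)e^{-int}dt$. *)

theory Defs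
  imports "HOL-Analysis.Analysis"
begin

text \<open>
  Functions on the unit circle are represented by \<open>2\<pi>\<close>-periodic functions on the reals, and
  elements of \<open>L\<^sup>2\<close> by arbitrary Lebesgue measurable representatives.
\<close>

definition L2_circle :: "(real \<Rightarrow> complex) \<Rightarrow> bool" where
  "L2_circle f \<longleftrightarrow>
     periodic_fun_simple f (2 * pi) \<and>
     f \<in> borel_measurable lebesgue \<and>
     set_integrable lebesgue {0..2 * pi} (\<lambda>\<theta>. (cmod (f \<theta>))\<^sup>2)"

definition fourier_coeff :: "(real \<Rightarrow> complex) \<Rightarrow> int \<Rightarrow> complex" where
  "fourier_coeff f n =
     1 / (2 * pi) * (LINT t:{0..2 * pi}|lebesgue. f t * exp (- (\<i> * of_int n * of_real t)))"

text \<open>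
  The distributional derivative on the circle, for the case that it is a function: \<open>g\<close> is
  determined by \<open>f\<close> only up to a null set, hence a relation. Testing against the functions
  \<open>exp (- \<i> n \<theta>)\<close> is testing against a total set of smooth periodic functions.
\<close>

definition has_circle_deriv :: "(real \<Rightarrow> complex) \<Rightarrow> (real \<Rightarrow> complex) \<Rightarrow> bool" where
  "has_circle_deriv f g \<longleftrightarrow>
     (\<forall>n::int. fourier_coeff g n = \<i> * of_int n * fourier_coeff f n)"

definition admissible :: "(real \<Rightarrow> complex) \<Rightarrow> (real \<Rightarrow> complex) \<Rightarrow> bool" where
  "admissible f f' \<longleftrightarrow>
     L2_circle f \<and> L2_circle f' \<and> has_circle_deriv f f' \<and>
     (LINT \<theta>:{0..2 * pi}|lebesgue. f \<theta>) = 0"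

end

theory Submission imports Defs begin

text \<open>
  In Fourier space the theorem is the discrete Hardy inequality. Let \<open>b\<^sub>n = i n a\<^sub>n\<close> be the
  Fourier coefficients of \<open>f'\<close>, where \<open>a\<^sub>n\<close> are those of \<open>f\<close>. As \<open>2 (1 - cos \<theta>)\<close> is the square of
  \<open>\<bar>1 - exp (i \<theta>)\<bar>\<close>, and multiplication by \<open>1 - exp (i \<theta>)\<close> acts on coefficients as the backward
  difference, the weighted energy is \<open>\<pi> \<Sum>\<^sub>n \<bar>b\<^sub>n - b\<^bsub>n-1\<^esub>\<bar>\<^sup>2\<close>, while \<open>\<integral> \<bar>f\<bar>\<^sup>2 = 2 \<pi> \<Sum>\<^sub>n \<bar>b\<^sub>n\<bar>\<^sup>2 / n\<^sup>2\<close>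
  since the mean \<open>a\<^sub>0\<close> vanishes. Because \<open>b\<^sub>0 = 0\<close>, Hardy's inequality
  \<open>\<Sum> \<bar>b\<^sub>n\<bar>\<^sup>2 / n\<^sup>2 \<le> 4 \<Sum> \<bar>b\<^sub>n - b\<^bsub>n-1\<^esub>\<bar>\<^sup>2\<close> applies separately to the positive and to the negative
  frequencies, and the factors combine to \<open>1 / 8\<close>.

  For the energy only a lower bound is needed, so Bessel's inequality suffices
  (\<open>sum_differences_le_weighted_integral\<close>). For \<open>\<integral> \<bar>f\<bar>\<^sup>2\<close> an upper bound is needed, and that is
  completeness of the characters (\<open>norm_le_of_fourier_coeff_sums_le\<close>): square integrable functions
  are approximated by their truncations, these almost everywhere by continuous functions on the
  circle, and these uniformly by trigonometric polynomials (Stone--Weierstrass).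

  Sharpness uses trigonometric polynomials, so that all integrals are finite sums. The near
  optimizers of Hardy's inequality are \<open>b\<^sub>n = \<surd>n\<close> up to a cutoff \<open>N\<close>, followed by a linear descent to
  \<open>0\<close> over the next \<open>N\<close> indices: then \<open>\<Sum> \<bar>b\<^sub>n\<bar>\<^sup>2 / n\<^sup>2\<close> is at least the harmonic number \<open>H\<^sub>N\<close>, the squared
  differences add up to at most \<open>2 + H\<^sub>N / 4\<close>, and \<open>H\<^sub>N\<close> is unbounded.
\<close>

section \<open>Characters and Bessel's inequality\<close>

abbreviation circle :: "real measure" where
  "circle \<equiv> lebesgue_on {0..2 * pi}"

lemma finite_measure_circle: "finite_measure circle"
  by (rule finite_measure_lebesgue_on) simp

interpretation circle: finite_measure circle
  by (rule finite_measure_circle)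

lemma circle_integral:
  fixes f :: "real \<Rightarrow> 'a::{banach, second_countable_topology}"
  shows "(LINT t:{0..2 * pi}|lebesgue. f t) = integral\<^sup>L circle f"
  by (simp add: set_lebesgue_integral_def integral_restrict_space)

lemma circle_integrable:
  fixes f :: "real \<Rightarrow> 'a::{banach, second_countable_topology}"
  shows "set_integrable lebesgue {0..2 * pi} f \<longleftrightarrow> integrable circle f"
  by (simp add: set_integrable_def integrable_restrict_space)

lemma continuous_measurable_circle:
  fixes f :: "real \<Rightarrow> 'a::{banach, second_countable_topology}"
  assumes "continuous_on UNIV f"
  shows "f \<in> borel_measurable circle"
  using assms by (intro continuous_imp_measurable_on_sets_lebesgue) (auto intro: continuous_on_subset)

definition character :: "int \<Rightarrow> real \<Rightarrow> complex" where
  "character n t = cis (of_int n * t)"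

lemma character_0 [simp]: "character 0 t = 1"
  by (simp add: character_def)

lemma norm_character [simp]: "cmod (character n t) = 1"
  by (simp add: character_def)

lemma character_mult: "character m t * character n t = character (m + n) t"
  by (simp add: character_def cis_mult algebra_simps)

lemma cnj_character: "cnj (character n t) = character (- n) t"
  by (simp add: character_def cis_cnj)

lemma continuous_character [continuous_intros]: "continuous_on S (character n)"
  unfolding character_def by (intro continuous_intros)

lemma measurable_character [measurable]: "character n \<in> borel_measurable circle"
  by (intro continuous_measurable_circle continuous_character)

lemma integral_character:
  "integral\<^sup>L circle (character n) = (if n = 0 then 2 * pi else 0)"
proof (cases "n = 0")
  case True
  have "character n = (\<lambda>t. 1)" using True by auto
  then show ?thesis using True by (simp add: measure_restrict_space scaleR_conv_of_real)
next
  case False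
  have "(character n has_integral (character n (2 * pi) / (\<i> * of_int n) - character n 0 / (\<i> * of_int n))) {0..2 * pi}"
  proof (rule fundamental_theorem_of_calculus)
    fix x :: real
    have "((\<lambda>t. exp (\<i> * of_int n * of_real t) / (\<i> * of_int n)) has_vector_derivative exp (\<i> * of_int n * of_real x)) (at x within {0..2 * pi})"
      using False by (auto intro!: derivative_eq_intros has_vector_derivative_real_field)
    then show "((\<lambda>t. character n t / (\<i> * of_int n)) has_vector_derivative character n x) (at x within {0..2 * pi})"
      by (simp add: character_def[abs_def] cis_conv_exp algebra_simps)
  qed simp
  moreover have "character n (2 * pi) = character n 0"
    using cis_multiple_2pi[of "of_int n"] by (simp add: character_def mult.commute)
  ultimately have "(character n has_integral 0) {0..2 * pi}" by simp
  moreover have "integrable circle (character n)"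
    by (rule circle.integrable_const_bound[of _ 1]) auto
  ultimately show ?thesis
    using False by (simp add: lebesgue_integral_eq_integral integral_unique)
qed

definition square_integrable :: "(real \<Rightarrow> complex) \<Rightarrow> bool" where
  "square_integrable f \<longleftrightarrow>
     f \<in> borel_measurable circle \<and> integrable circle (\<lambda>t. (cmod (f t))\<^sup>2)"

lemma square_integrable_bounded:
  assumes [measurable]: "f \<in> borel_measurable circle" and "\<And>t. cmod (f t) \<le> K"
  shows "square_integrable f"
  unfolding square_integrable_def
proof
  have "(cmod (f t))\<^sup>2 \<le> K\<^sup>2" for t
    using assms(2)[of t] by (intro power_mono) auto
  then show "integrable circle (\<lambda>t. (cmod (f t))\<^sup>2)"
    by (intro circle.integrable_const_bound[of _ "K\<^sup>2"]) auto
qed fact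

lemma norm_add_square_le: "(cmod (z + w))\<^sup>2 \<le> 2 * (cmod z)\<^sup>2 + 2 * (cmod w)\<^sup>2"
proof -
  have "(cmod (z + w))\<^sup>2 \<le> (cmod z + cmod w)\<^sup>2"
    by (intro power_mono norm_triangle_ineq) auto
  also have "\<dots> \<le> 2 * (cmod z)\<^sup>2 + 2 * (cmod w)\<^sup>2"
    using zero_le_power2[of "cmod z - cmod w"] by (simp add: power2_eq_square algebra_simps)
  finally show ?thesis .
qed

lemma square_integrable_add:
  assumes "square_integrable f" "square_integrable g"
  shows "square_integrable (\<lambda>t. f t + g t)"
proof -
  have [measurable]: "f \<in> borel_measurable circle" "g \<in> borel_measurable circle"
    using assms by (auto simp: square_integrable_def)
  have "integrable circle (\<lambda>t. 2 * (cmod (f t))\<^sup>2 + 2 * (cmod (g t))\<^sup>2)"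
    using assms by (auto simp: square_integrable_def)
  then have "integrable circle (\<lambda>t. (cmod (f t + g t))\<^sup>2)"
    by (rule Bochner_Integration.integrable_bound) (auto simp: norm_add_square_le)
  then show ?thesis by (simp add: square_integrable_def)
qed

lemma square_integrable_mult_bounded:
  assumes "square_integrable f" and [measurable]: "g \<in> borel_measurable circle"
    and "\<And>t. cmod (g t) \<le> K"
  shows "square_integrable (\<lambda>t. g t * f t)"
proof -
  have [measurable]: "f \<in> borel_measurable circle"
    using assms by (auto simp: square_integrable_def)
  have "integrable circle (\<lambda>t. K\<^sup>2 * (cmod (f t))\<^sup>2)"
    using assms by (auto simp: square_integrable_def)
  moreover have "(cmod (g t))\<^sup>2 \<le> K\<^sup>2" for t
    using assms(3)[of t] by (intro power_mono) auto
  ultimately have "integrable circle (\<lambda>t. (cmod (g t * f t))\<^sup>2)"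
    by (elim Bochner_Integration.integrable_bound)
      (auto simp: norm_mult power_mult_distrib mult_right_mono)
  then show ?thesis by (simp add: square_integrable_def)
qed

lemma square_integrable_diff:
  assumes "square_integrable f" "square_integrable g"
  shows "square_integrable (\<lambda>t. f t - g t)"
  using square_integrable_add[OF assms(1) square_integrable_mult_bounded[OF assms(2), of "\<lambda>_. -1" 1]]
  by simp

lemma square_integrable_imp_integrable:
  assumes "square_integrable f"
  shows "integrable circle f"
proof -
  have [measurable]: "f \<in> borel_measurable circle"
    using assms by (auto simp: square_integrable_def)
  have "integrable circle (\<lambda>t. 1 + (cmod (f t))\<^sup>2)"
    using assms by (auto simp: square_integrable_def)
  moreover have "x \<le> 1 + x\<^sup>2" for x :: real
    using zero_le_power2[of "2 * x - 1"]
    by (simp add: power2_eq_square algebra_simps)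
  ultimately show ?thesis
    by (elim Bochner_Integration.integrable_bound) auto
qed

lemma integrable_mult_character:
  assumes "square_integrable f"
  shows "integrable circle (\<lambda>t. f t * character n t)"
  using square_integrable_imp_integrable[OF square_integrable_mult_bounded[OF assms measurable_character, of n 1]]
  by (simp add: mult.commute)

lemma fourier_coeff_character:
  "integral\<^sup>L circle (\<lambda>t. f t * character (- n) t) = 2 * pi * fourier_coeff f n"
  unfolding fourier_coeff_def circle_integral
  by (simp add: character_def cis_conv_exp algebra_simps)

definition trig_sum :: "int set \<Rightarrow> (int \<Rightarrow> complex) \<Rightarrow> real \<Rightarrow> complex" where
  "trig_sum A c t = (\<Sum>n\<in>A. c n * character n t)"

lemma continuous_trig_sum: "continuous_on S (trig_sum A c)"
  unfolding trig_sum_def[abs_def] by (intro continuous_intros)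

lemma square_integrable_trig_sum: "square_integrable (trig_sum A c)"
proof (rule square_integrable_bounded)
  show "trig_sum A c \<in> borel_measurable circle"
    by (intro continuous_measurable_circle continuous_trig_sum)
  show "cmod (trig_sum A c t) \<le> (\<Sum>n\<in>A. cmod (c n))" for t
    unfolding trig_sum_def by (rule order_trans[OF norm_sum]) (simp add: norm_mult)
qed

lemma fourier_coeff_trig_sum:
  assumes "finite A"
  shows "fourier_coeff (trig_sum A c) n = (if n \<in> A then c n else 0)"
proof -
  have "2 * pi * fourier_coeff (trig_sum A c) n = integral\<^sup>L circle (\<lambda>t. \<Sum>m\<in>A. c m * character (m - n) t)"
    unfolding fourier_coeff_character[symmetric]
    by (simp add: trig_sum_def sum_distrib_right mult.assoc character_mult)
  also have "\<dots> = (\<Sum>m\<in>A. c m * integral\<^sup>L circle (character (m - n)))"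
    using circle.integrable_const_bound[of "character _" 1]
    by (subst Bochner_Integration.integral_sum) auto
  also have "\<dots> = (\<Sum>m\<in>A. if m = n then 2 * pi * c m else 0)"
    by (intro sum.cong) (auto simp: integral_character)
  also have "\<dots> = 2 * pi * (if n \<in> A then c n else 0)"
    using assms by (simp add: sum.delta)
  finally show ?thesis by simp
qed

lemma integral_mult_cnj_trig_sum:
  assumes "square_integrable f"
  shows "integral\<^sup>L circle (\<lambda>t. f t * cnj (trig_sum A c t)) = 2 * pi * (\<Sum>n\<in>A. fourier_coeff f n * cnj (c n))"
proof -
  have "integral\<^sup>L circle (\<lambda>t. f t * cnj (trig_sum A c t))
      = integral\<^sup>L circle (\<lambda>t. \<Sum>n\<in>A. cnj (c n) * (f t * character (- n) t))"
    by (simp add: trig_sum_def cnj_character sum_distrib_left algebra_simps)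
  also have "\<dots> = (\<Sum>n\<in>A. cnj (c n) * (2 * pi * fourier_coeff f n))"
    using integrable_mult_character[OF assms]
    by (subst Bochner_Integration.integral_sum) (auto simp: fourier_coeff_character)
  finally show ?thesis by (simp add: sum_distrib_left algebra_simps)
qed

lemma norm_trig_sum:
  assumes "finite A"
  shows "integral\<^sup>L circle (\<lambda>t. (cmod (trig_sum A c t))\<^sup>2) = 2 * pi * (\<Sum>n\<in>A. (cmod (c n))\<^sup>2)"
proof -
  have "complex_of_real (integral\<^sup>L circle (\<lambda>t. (cmod (trig_sum A c t))\<^sup>2))
      = integral\<^sup>L circle (\<lambda>t. trig_sum A c t * cnj (trig_sum A c t))"
    unfolding integral_complex_of_real[symmetric] complex_norm_square ..
  also have "\<dots> = 2 * pi * (\<Sum>n\<in>A. fourier_coeff (trig_sum A c) n * cnj (c n))"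
    by (rule integral_mult_cnj_trig_sum[OF square_integrable_trig_sum])
  also have "\<dots> = of_real (2 * pi * (\<Sum>n\<in>A. (cmod (c n))\<^sup>2))"
    by (simp add: fourier_coeff_trig_sum[OF assms] complex_norm_square[symmetric] flip: of_real_power)
  finally show ?thesis by (simp only: of_real_eq_iff)
qed

text \<open>
  Completing the square in the coefficients. The choice \<open>c = fourier_coeff f\<close> gives Bessel's
  inequality; keeping \<open>c\<close> free, the last sum being nonnegative, turns an approximation of \<open>f\<close> into a
  lower bound for its coefficient sums.
\<close>

lemma distance_trig_sum:
  assumes f: "square_integrable f" and A: "finite A"
  shows "integral\<^sup>L circle (\<lambda>t. (cmod (f t - trig_sum A c t))\<^sup>2)
    = integral\<^sup>L circle (\<lambda>t. (cmod (f t))\<^sup>2)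
      - 2 * pi * (\<Sum>n\<in>A. (cmod (fourier_coeff f n))\<^sup>2)
      + 2 * pi * (\<Sum>n\<in>A. (cmod (fourier_coeff f n - c n))\<^sup>2)"
proof -
  let ?T = "trig_sum A c"
  have mult: "integrable circle (\<lambda>t. f t * cnj (?T t))"
    unfolding trig_sum_def using integrable_mult_character[OF f]
    by (auto simp: cnj_character sum_distrib_left mult.left_commute[of "f _"])
  have expand: "(cmod (z - w))\<^sup>2 = (cmod z)\<^sup>2 - 2 * Re (z * cnj w) + (cmod w)\<^sup>2" for z w
    by (simp add: cmod_power2) (simp add: power2_eq_square algebra_simps)
  have "integral\<^sup>L circle (\<lambda>t. (cmod (f t - ?T t))\<^sup>2)
      = integral\<^sup>L circle (\<lambda>t. (cmod (f t))\<^sup>2) - 2 * Re (integral\<^sup>L circle (\<lambda>t. f t * cnj (?T t)))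
        + integral\<^sup>L circle (\<lambda>t. (cmod (?T t))\<^sup>2)"
  proof -
    have "integrable circle (\<lambda>t. (cmod (f t))\<^sup>2)" "integrable circle (\<lambda>t. (cmod (?T t))\<^sup>2)"
      "integrable circle (\<lambda>t. 2 * Re (f t * cnj (?T t)))"
      using f square_integrable_trig_sum[of A c] integrable_Re[OF mult]
      by (simp_all add: square_integrable_def del: times_complex.sel)
    then show ?thesis
      unfolding expand using integral_Re[OF mult] by (simp del: times_complex.sel)
  qed
  also have "\<dots> = integral\<^sup>L circle (\<lambda>t. (cmod (f t))\<^sup>2)
      - 2 * pi * (\<Sum>n\<in>A. 2 * Re (fourier_coeff f n * cnj (c n)) - (cmod (c n))\<^sup>2)"
  proof -
    have "Re (complex_of_real (2 * pi) * z) = 2 * pi * Re z" for z by simp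
    then show ?thesis
      unfolding integral_mult_cnj_trig_sum[OF f] norm_trig_sum[OF A]
      by (simp only: Re_sum sum_subtractf sum_distrib_left[symmetric]) (simp only: algebra_simps)
  qed
  also have "(\<Sum>n\<in>A. 2 * Re (fourier_coeff f n * cnj (c n)) - (cmod (c n))\<^sup>2)
      = (\<Sum>n\<in>A. (cmod (fourier_coeff f n))\<^sup>2 - (cmod (fourier_coeff f n - c n))\<^sup>2)"
    unfolding expand by (simp add: algebra_simps)
  finally show ?thesis by (simp add: sum_subtractf algebra_simps)
qed

lemma bessel_inequality:
  assumes f: "square_integrable f" and A: "finite A"
  shows "2 * pi * (\<Sum>n\<in>A. (cmod (fourier_coeff f n))\<^sup>2) \<le> integral\<^sup>L circle (\<lambda>t. (cmod (f t))\<^sup>2)"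
proof -
  have "0 \<le> integral\<^sup>L circle (\<lambda>t. (cmod (f t - trig_sum A (fourier_coeff f) t))\<^sup>2)"
    by simp
  then show ?thesis unfolding distance_trig_sum[OF assms] by simp
qed

section \<open>Density of the trigonometric polynomials\<close>

definition trig_poly :: "(real \<Rightarrow> complex) \<Rightarrow> bool" where
  "trig_poly T \<longleftrightarrow> (\<exists>A c. finite A \<and> T = trig_sum A c)"

lemma trig_poly_monomial: "trig_poly (\<lambda>t. a * character n t)"
  unfolding trig_poly_def trig_sum_def[abs_def]
  by (rule exI[of _ "{n}"], rule exI[of _ "\<lambda>_. a"]) simp

lemma trig_poly_const: "trig_poly (\<lambda>t. a)"
  using trig_poly_monomial[of a 0] by simp

lemma trig_poly_add:
  assumes "trig_poly S" "trig_poly T"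
  shows "trig_poly (\<lambda>t. S t + T t)"
proof -
  obtain A a B b where S: "finite A" "S = trig_sum A a" and T: "finite B" "T = trig_sum B b"
    using assms by (auto simp: trig_poly_def)
  define c where "c = (\<lambda>n. (if n \<in> A then a n else 0) + (if n \<in> B then b n else 0))"
  have "trig_sum (A \<union> B) c t = S t + T t" for t
  proof -
    have "(\<Sum>n\<in>A \<union> B. (if n \<in> A then a n else 0) * character n t) = S t"
      unfolding S trig_sum_def using S T by (intro sum.mono_neutral_cong_right) auto
    moreover have "(\<Sum>n\<in>A \<union> B. (if n \<in> B then b n else 0) * character n t) = T t"
      unfolding T trig_sum_def using S T by (intro sum.mono_neutral_cong_right) auto
    ultimately show ?thesis
      unfolding trig_sum_def c_def by (simp add: distrib_right sum.distrib)
  qed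
  then show ?thesis
    unfolding trig_poly_def using S T by (intro exI[of _ "A \<union> B"] exI[of _ c]) auto
qed

lemma trig_poly_sum:
  assumes "finite I" "\<And>i. i \<in> I \<Longrightarrow> trig_poly (F i)"
  shows "trig_poly (\<lambda>t. \<Sum>i\<in>I. F i t)"
  using assms by (induction I) (auto intro: trig_poly_const trig_poly_add)

lemma trig_poly_mult:
  assumes "trig_poly S" "trig_poly T"
  shows "trig_poly (\<lambda>t. S t * T t)"
proof -
  obtain A a B b where S: "finite A" "S = trig_sum A a" and T: "finite B" "T = trig_sum B b"
    using assms by (auto simp: trig_poly_def)
  have "S t * T t = (\<Sum>m\<in>A. \<Sum>n\<in>B. (a m * b n) * character (m + n) t)" for t
    by (simp add: S T trig_sum_def sum_product character_mult[symmetric] mult_ac)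
  moreover have "trig_poly (\<lambda>t. \<Sum>m\<in>A. \<Sum>n\<in>B. (a m * b n) * character (m + n) t)"
    using S T by (intro trig_poly_sum trig_poly_monomial)
  ultimately show ?thesis by simp
qed

text \<open>
  Stone--Weierstrass provides polynomials in the real and the imaginary part of \<open>z\<close>. On the unit circle
  both parts are combinations of \<open>z\<close> and \<open>1 / z\<close>, and trigonometric polynomials are closed under
  products.
\<close>

lemma real_polynomial_function_cis:
  fixes p :: "complex \<Rightarrow> real"
  assumes "real_polynomial_function p"
  shows "trig_poly (\<lambda>t. of_real (p (cis t)))"
  using assms
proof induction
  case (linear h)
  interpret bounded_linear h by fact
  define a b where "a = complex_of_real (h 1)" and "b = complex_of_real (h \<i>)"
  have decompose: "h z = Re z * h 1 + Im z * h \<i>" for z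
  proof -
    have "z = Re z *\<^sub>R 1 + Im z *\<^sub>R \<i>" by (simp add: complex_eq_iff)
    then have "h z = h (Re z *\<^sub>R 1 + Im z *\<^sub>R \<i>)" by simp
    then show ?thesis unfolding add scale by simp
  qed
  have "of_real (h (cis t))
      = ((a - \<i> * b) / 2) * character 1 t + ((a + \<i> * b) / 2) * character (-1) t" for t
    unfolding decompose[of "cis t"] by (simp add: character_def a_def b_def complex_eq_iff field_simps)
  then show ?case
    by (simp only:) (intro trig_poly_add trig_poly_monomial)
next
  case (const c)
  show ?case by (rule trig_poly_const)
next
  case (add p q)
  then show ?case by (simp add: trig_poly_add)
next
  case (mult p q)
  then show ?case by (simp add: trig_poly_mult)
qed

lemma trig_poly_uniformly_dense:
  fixes \<Phi> :: "complex \<Rightarrow> complex"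
  assumes "continuous_on (sphere 0 1) \<Phi>" and "e > 0"
  obtains T where "trig_poly T" "\<And>t. cmod (\<Phi> (cis t) - T t) < e"
proof -
  obtain g where g: "polynomial_function g" "\<And>z. z \<in> sphere 0 1 \<Longrightarrow> cmod (\<Phi> z - g z) < e"
    using Stone_Weierstrass_polynomial_function[OF compact_sphere assms] by blast
  have "real_polynomial_function (\<lambda>z. Re (g z))" "real_polynomial_function (\<lambda>z. Im (g z))"
    using g(1) bounded_linear_Re bounded_linear_Im unfolding polynomial_function_def o_def by blast+
  then have "trig_poly (\<lambda>t. of_real (Re (g (cis t))) + \<i> * of_real (Im (g (cis t))))"
    by (intro trig_poly_add trig_poly_mult trig_poly_const)
       (auto dest: real_polynomial_function_cis)
  then have "trig_poly (\<lambda>t. g (cis t))"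
    by (simp flip: complex_eq)
  then show ?thesis using g(2) that by auto
qed

text \<open>
  Membership in the closure of the trigonometric polynomials in \<open>L\<^sup>2\<close>.
\<close>

definition trig_approximable :: "(real \<Rightarrow> complex) \<Rightarrow> bool" where
  "trig_approximable f \<longleftrightarrow> square_integrable f \<and>
     (\<forall>e>0. \<exists>T. trig_poly T \<and> integral\<^sup>L circle (\<lambda>t. (cmod (f t - T t))\<^sup>2) < e)"

lemma trig_approximable_continuous:
  fixes \<Phi> :: "complex \<Rightarrow> complex"
  assumes \<Phi>: "continuous_on (sphere 0 1) \<Phi>"
  shows "trig_approximable (\<lambda>t. \<Phi> (cis t))"
proof -
  obtain K where K: "\<And>z. z \<in> sphere 0 1 \<Longrightarrow> cmod (\<Phi> z) \<le> K"
    using compact_imp_bounded[OF compact_continuous_image[OF \<Phi> compact_sphere]]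
    unfolding bounded_iff by blast
  have cont: "continuous_on UNIV (\<lambda>t. \<Phi> (cis t))"
    by (rule continuous_on_compose2[OF \<Phi>]) (auto intro!: continuous_intros)
  have sq: "square_integrable (\<lambda>t. \<Phi> (cis t))"
    using K by (intro square_integrable_bounded[of _ K] continuous_measurable_circle cont) auto
  moreover have "\<exists>T. trig_poly T \<and> integral\<^sup>L circle (\<lambda>t. (cmod (\<Phi> (cis t) - T t))\<^sup>2) < e"
    if "e > 0" for e
  proof -
    \<comment> \<open>a uniform error \<open>d\<close> has squared norm at most \<open>2 * pi * d\<^sup>2\<close>, here \<open>e / 2\<close>\<close>
    define d where "d = sqrt (e / (4 * pi))"
    have d: "d > 0" "d\<^sup>2 = e / (4 * pi)" using that by (auto simp: d_def)
    obtain T where T: "trig_poly T" "\<And>t. cmod (\<Phi> (cis t) - T t) < d"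
      using trig_poly_uniformly_dense[OF \<Phi> d(1)] by blast
    have "square_integrable (\<lambda>t. \<Phi> (cis t) - T t)"
      using T(1) square_integrable_trig_sum by (intro square_integrable_diff sq) (auto simp: trig_poly_def)
    then have "integral\<^sup>L circle (\<lambda>t. (cmod (\<Phi> (cis t) - T t))\<^sup>2) \<le> integral\<^sup>L circle (\<lambda>t. d\<^sup>2)"
      using T(2) by (intro integral_mono power_mono) (auto simp: square_integrable_def less_imp_le)
    also have "\<dots> < e"
      using that by (simp add: measure_restrict_space d)
    finally show ?thesis using T(1) by blast
  qed
  ultimately show ?thesis by (simp add: trig_approximable_def)
qed

text \<open>
  Dominated convergence in \<open>L\<^sup>2\<close>, combined with the fact that a closure is closed. It is used
  to pass from continuous to bounded, and from bounded to square integrable functions.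
\<close>

lemma trig_approximable_limit:
  assumes f: "square_integrable f" and g: "\<And>k. trig_approximable (g k)"
    and lim: "AE t in circle. (\<lambda>k. g k t) \<longlonglongrightarrow> f t"
    and bound: "\<And>k t. cmod (f t - g k t) \<le> w t"
    and w: "integrable circle (\<lambda>t. (w t)\<^sup>2)"
  shows "trig_approximable f"
  unfolding trig_approximable_def
proof (intro conjI allI impI f)
  fix e :: real assume e: "e > 0"
  have sq: "square_integrable (g k)" for k using g by (simp add: trig_approximable_def)
  then have [measurable]: "f \<in> borel_measurable circle" "g k \<in> borel_measurable circle" for k
    using f by (auto simp: square_integrable_def)
  have "(\<lambda>k. integral\<^sup>L circle (\<lambda>t. (cmod (f t - g k t))\<^sup>2)) \<longlonglongrightarrow> integral\<^sup>L circle (\<lambda>t. 0)"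
  proof (rule integral_dominated_convergence[where w="\<lambda>t. (w t)\<^sup>2"])
    show "AE t in circle. (\<lambda>k. (cmod (f t - g k t))\<^sup>2) \<longlonglongrightarrow> 0"
      using lim
    proof eventually_elim
      case (elim t)
      have "(\<lambda>k. (cmod (f t - g k t))\<^sup>2) \<longlonglongrightarrow> (cmod (f t - f t))\<^sup>2"
        using elim by (intro tendsto_intros)
      then show ?case by simp
    qed
    show "AE t in circle. norm ((cmod (f t - g k t))\<^sup>2) \<le> (w t)\<^sup>2" for k
      using bound[where k=k] by (auto intro!: power_mono)
  qed (use w in auto)
  then have "\<forall>\<^sub>F k in sequentially. integral\<^sup>L circle (\<lambda>t. (cmod (f t - g k t))\<^sup>2) < e / 4"
    using e by (intro order_tendstoD(2)) auto
  then obtain k where k: "integral\<^sup>L circle (\<lambda>t. (cmod (f t - g k t))\<^sup>2) < e / 4"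
    by (auto simp: eventually_sequentially)
  obtain T where T: "trig_poly T" "integral\<^sup>L circle (\<lambda>t. (cmod (g k t - T t))\<^sup>2) < e / 4"
    using g[of k] e unfolding trig_approximable_def by (meson zero_less_divide_iff zero_less_numeral)
  have sqT: "square_integrable T"
    using T(1) square_integrable_trig_sum by (auto simp: trig_poly_def)
  have "integral\<^sup>L circle (\<lambda>t. (cmod (f t - T t))\<^sup>2)
      \<le> integral\<^sup>L circle (\<lambda>t. 2 * (cmod (f t - g k t))\<^sup>2 + 2 * (cmod (g k t - T t))\<^sup>2)"
  proof (rule integral_mono)
    show "(cmod (f t - T t))\<^sup>2 \<le> 2 * (cmod (f t - g k t))\<^sup>2 + 2 * (cmod (g k t - T t))\<^sup>2" for t
      using norm_add_square_le[of "f t - g k t" "g k t - T t"] by simp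
  qed (use square_integrable_diff[OF f sq[of k]] square_integrable_diff[OF sq[of k] sqT]
      square_integrable_diff[OF f sqT] in \<open>auto simp: square_integrable_def\<close>)
  also have "\<dots> = 2 * integral\<^sup>L circle (\<lambda>t. (cmod (f t - g k t))\<^sup>2)
      + 2 * integral\<^sup>L circle (\<lambda>t. (cmod (g k t - T t))\<^sup>2)"
    using square_integrable_diff[OF f sq[of k]] square_integrable_diff[OF sq[of k] sqT]
    by (auto simp: square_integrable_def)
  \<comment> \<open>\<open>\<bar>z + w\<bar>\<^sup>2 \<le> 2 \<bar>z\<bar>\<^sup>2 + 2 \<bar>w\<bar>\<^sup>2\<close> costs a factor \<open>2\<close>, hence the tolerance \<open>e / 4\<close> for each part\<close>
  also have "\<dots> < e" using k T by linarith
  finally show "\<exists>T. trig_poly T \<and> integral\<^sup>L circle (\<lambda>t. (cmod (f t - T t))\<^sup>2) < e"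
    using T(1) by blast
qed

text \<open>
  The radial retraction onto the disc of radius \<open>K\<close>, written without a case distinction on \<open>z\<close> so that
  continuity is immediate.
\<close>

definition clip :: "real \<Rightarrow> complex \<Rightarrow> complex" where
  "clip K z = (K / max K (cmod z)) *\<^sub>R z"

lemma norm_clip_le: "K > 0 \<Longrightarrow> cmod (clip K z) \<le> K"
  by (auto simp: clip_def max_def field_simps)

lemma clip_eq: "K > 0 \<Longrightarrow> cmod z \<le> K \<Longrightarrow> clip K z = z"
  by (simp add: clip_def max_def)

lemma norm_diff_clip_le: "K > 0 \<Longrightarrow> cmod (z - clip K z) \<le> cmod z"
proof -
  assume K: "K > 0"
  have "z - clip K z = (1 - K / max K (cmod z)) *\<^sub>R z"
    by (simp add: clip_def scaleR_diff_left)
  moreover have "\<bar>1 - K / max K (cmod z)\<bar> \<le> 1"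
    using K by (simp add: abs_le_iff divide_simps)
  ultimately show ?thesis by (simp add: mult_left_le_one_le)
qed

lemma continuous_clip: "K > 0 \<Longrightarrow> continuous_on S (clip K)"
  unfolding clip_def[abs_def] by (intro continuous_intros) (auto simp: max_def)

text \<open>
  A function on the line, read off on one period, jumps at the point \<open>1\<close> of the circle. The factor
  \<open>min 1 (k * cmod (z - 1))\<close> vanishes there, which repairs continuity, and it equals \<open>1\<close> at any
  other given point once \<open>k\<close> is large.
\<close>

lemma continuous_on_sphere_cutoff:
  fixes g :: "real \<Rightarrow> complex"
  assumes g: "continuous_on UNIV g" and bound: "\<And>t. cmod (g t) \<le> K"
  shows "continuous_on (sphere 0 1) (\<lambda>z. min 1 (k * cmod (z - 1)) *\<^sub>R g (Arg2pi z))"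
  unfolding continuous_on_eq_continuous_within
proof
  fix z :: complex assume z: "z \<in> sphere 0 1"
  let ?m = "\<lambda>z. min 1 (k * cmod (z - 1))"
  have m: "(?m \<longlongrightarrow> ?m a) (at a within sphere 0 1)" for a by (intro tendsto_intros)
  show "continuous (at z within sphere 0 1) (\<lambda>z. ?m z *\<^sub>R g (Arg2pi z))"
  proof (cases "z = 1")
    case True
    have "((\<lambda>z. ?m z *\<^sub>R g (Arg2pi z)) \<longlongrightarrow> 0) (at 1 within sphere 0 1)"
    proof (rule Lim_null_comparison)
      show "\<forall>\<^sub>F z in at 1 within sphere 0 1. norm (?m z *\<^sub>R g (Arg2pi z)) \<le> \<bar>?m z\<bar> * K"
        using bound by (auto intro!: always_eventually mult_left_mono)
      show "((\<lambda>z. \<bar>?m z\<bar> * K) \<longlongrightarrow> 0) (at 1 within sphere 0 1)"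
        using tendsto_mult[OF tendsto_rabs[OF m[of 1]] tendsto_const[of K]] by simp
    qed
    then show ?thesis using True by (simp add: continuous_within)
  next
    case False
    have "z \<notin> \<real>\<^sub>\<ge>\<^sub>0"
      using z False by (auto simp: nonneg_Reals_def)
    then have "isCont Arg2pi z" by (rule continuous_at_Arg2pi)
    then have "isCont (\<lambda>z. g (Arg2pi z)) z"
    proof (rule isCont_o2)
      show "isCont g (Arg2pi z)" using g by (simp add: continuous_on_eq_continuous_at)
    qed
    then show ?thesis
      unfolding continuous_within
      by (intro tendsto_scaleR m) (auto simp: isCont_def intro: tendsto_within_subset)
  qed
qed

lemma Arg2pi_cis: "0 \<le> t \<Longrightarrow> t < 2 * pi \<Longrightarrow> Arg2pi (cis t) = t"
  by (rule Arg2pi_unique[of 1]) (auto simp: cis_conv_exp)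

lemma negligible_imp_AE_circle:
  assumes "negligible N" shows "AE t in circle. t \<notin> N"
proof -
  have "AE t in lebesgue. t \<notin> N"
    using assms by (simp add: negligible_iff_null_sets AE_not_in)
  then show ?thesis
    by (subst AE_restrict_space_iff) (auto elim: eventually_mono)
qed

text \<open>
  A measurable function is the almost everywhere limit of functions \<open>g k\<close> that are continuous on the
  line. Clipping at the bound \<open>K\<close> makes them dominated, and the cutoff at \<open>1\<close> makes them continuous on
  the circle; neither changes the limit away from the endpoints of the period.
\<close>

lemma trig_approximable_bounded:
  assumes f [measurable]: "f \<in> borel_measurable circle" and K: "K > 0" and bound: "\<And>t. cmod (f t) \<le> K"
  shows "trig_approximable f"
proof -
  have "f measurable_on {0..2 * pi}"
    by (rule measurable_on_iff_borel_measurable[THEN iffD2, OF _ f]) simp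
  then obtain N g where N: "negligible N" and g: "\<And>k. continuous_on UNIV (g k)"
    and lim: "\<And>t. t \<notin> N \<Longrightarrow> (\<lambda>k. g k t) \<longlonglongrightarrow> (if t \<in> {0..2 * pi} then f t else 0)"
    unfolding measurable_on_def by blast
  let ?m = "\<lambda>(k::nat) z. min 1 (real k * cmod (z - 1))"
  define p where "p k t = ?m k (cis t) *\<^sub>R clip K (g k (Arg2pi (cis t)))" for k t
  show ?thesis
  proof (rule trig_approximable_limit)
    show "square_integrable f"
      using bound by (intro square_integrable_bounded[of f K]) auto
    show "trig_approximable (p k)" for k
      unfolding p_def
      by (rule trig_approximable_continuous[of "\<lambda>z. ?m k z *\<^sub>R clip K (g k (Arg2pi z))"],
          rule continuous_on_sphere_cutoff[of _ K])
         (use K g in \<open>auto intro: norm_clip_le continuous_on_compose2[OF continuous_clip[OF K, of UNIV]]\<close>)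
    show "AE t in circle. (\<lambda>k. p k t) \<longlonglongrightarrow> f t"
    proof -
      have "negligible (N \<union> {0, 2 * pi})" using N by (intro negligible_Un) auto
      from negligible_imp_AE_circle[OF this] AE_space
      show ?thesis
      proof eventually_elim
        case (elim t)
        then have t: "0 < t" "t < 2 * pi" "t \<notin> N" by (auto simp: less_le)
        then have lim_t: "(\<lambda>k. g k t) \<longlonglongrightarrow> f t" using lim[of t] by simp
        have "cis t \<noteq> 1"
        proof
          assume "cis t = 1"
          then have "Arg2pi (cis t) = 0" by (simp add: Arg2pi_eq_0)
          then show False using t by (simp add: Arg2pi_cis)
        qed
        then have pos: "cmod (cis t - 1) > 0" by simp
        obtain k0 where k0: "1 / cmod (cis t - 1) < real k0" using reals_Archimedean2 by blast
        have "?m k (cis t) = 1" if "k \<ge> k0" for k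
        proof -
          have "1 / cmod (cis t - 1) \<le> real k" using k0 that by linarith
          then show ?thesis using pos by (simp add: field_simps min_def)
        qed
        then have "\<forall>\<^sub>F k in sequentially. p k t = clip K (g k t)"
          using t by (auto simp: eventually_sequentially p_def Arg2pi_cis intro!: exI[of _ k0])
        moreover have "(\<lambda>k. clip K (g k t)) \<longlonglongrightarrow> clip K (f t)"
          using continuous_clip[OF K, of UNIV] lim_t
          by (intro isCont_tendsto_compose[of _ "clip K"]) (auto simp: continuous_on_eq_continuous_at)
        ultimately show ?case
          using clip_eq[OF K bound] by (simp add: tendsto_cong)
      qed
    qed
    show "cmod (f t - p k t) \<le> 2 * K" for k t
    proof -
      have "cmod (p k t) \<le> 1 * K"
        unfolding p_def norm_scaleR using K by (intro mult_mono norm_clip_le) (auto simp: min_def)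
      then show ?thesis using bound[of t] norm_triangle_ineq4[of "f t" "p k t"] by linarith
    qed
  qed auto
qed

lemma trig_poly_dense_L2:
  assumes f: "square_integrable f"
  shows "trig_approximable f"
proof (rule trig_approximable_limit[OF f])
  fix k :: nat
  let ?K = "real (Suc k)"
  have "clip ?K \<in> borel_measurable borel"
    by (intro borel_measurable_continuous_onI continuous_clip) simp
  then have "(\<lambda>t. clip ?K (f t)) \<in> borel_measurable circle"
    using f by (intro measurable_compose[of f circle borel "clip ?K"]) (auto simp: square_integrable_def)
  then show "trig_approximable (\<lambda>t. clip ?K (f t))"
    by (intro trig_approximable_bounded[of _ ?K] norm_clip_le) auto
  show "cmod (f t - clip ?K (f t)) \<le> cmod (f t)" for t
    by (intro norm_diff_clip_le) simp
next
  show "AE t in circle. (\<lambda>k. clip (real (Suc k)) (f t)) \<longlonglongrightarrow> f t"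
  proof (rule AE_I2)
    fix t
    obtain k0 where "cmod (f t) < real k0" using reals_Archimedean2 by blast
    then have "\<forall>\<^sub>F k in sequentially. clip (real (Suc k)) (f t) = f t"
      unfolding eventually_sequentially by (intro exI[of _ k0]) (auto intro!: clip_eq)
    then show "(\<lambda>k. clip (real (Suc k)) (f t)) \<longlonglongrightarrow> f t"
      by (rule tendsto_eventually)
  qed
qed (use f in \<open>auto simp: square_integrable_def\<close>)

text \<open>
  Completeness of the characters: the nontrivial half of Parseval's identity, in the form of a bound.
\<close>

lemma norm_le_of_fourier_coeff_sums_le:
  assumes f: "square_integrable f"
    and B: "\<And>A. finite A \<Longrightarrow> 2 * pi * (\<Sum>n\<in>A. (cmod (fourier_coeff f n))\<^sup>2) \<le> B"
  shows "integral\<^sup>L circle (\<lambda>t. (cmod (f t))\<^sup>2) \<le> B"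
proof (rule field_le_epsilon)
  fix e :: real assume "e > 0"
  then obtain A c where A: "finite A"
    and e: "integral\<^sup>L circle (\<lambda>t. (cmod (f t - trig_sum A c t))\<^sup>2) < e"
    using trig_poly_dense_L2[OF f] by (auto simp: trig_approximable_def trig_poly_def)
  have "0 \<le> 2 * pi * (\<Sum>n\<in>A. (cmod (fourier_coeff f n - c n))\<^sup>2)"
    by (intro mult_nonneg_nonneg sum_nonneg) auto
  then show "integral\<^sup>L circle (\<lambda>t. (cmod (f t))\<^sup>2) \<le> B + e"
    using e B[OF A] unfolding distance_trig_sum[OF f A] by linarith
qed

section \<open>The discrete Hardy inequality and the weighted energy\<close>

text \<open>
  The induction carries the boundary term \<open>\<bar>b N\<bar>\<^sup>2 / (2 N)\<close>. Minimizing
  \<open>(x - y)\<^sup>2 + y\<^sup>2 / (2 r)\<close> over \<open>y\<close> leaves \<open>x\<^sup>2 / (2 r + 1)\<close>, and this covers both the new summand and the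
  new boundary term, because \<open>(2 r + 1) (2 r + 3) \<le> (2 r + 2)\<^sup>2\<close>.
\<close>

lemma discrete_hardy:
  fixes b :: "nat \<Rightarrow> complex"
  assumes b0: "b 0 = 0"
  shows "(\<Sum>n<N. (cmod (b (Suc n)))\<^sup>2 / (real (Suc n))\<^sup>2) \<le> 4 * (\<Sum>n<N. (cmod (b (Suc n) - b n))\<^sup>2)"
proof -
  \<comment> \<open>for \<open>N = 0\<close> the boundary term is \<open>0 / 0 = 0\<close>\<close>
  have "(\<Sum>n<N. (cmod (b (Suc n)))\<^sup>2 / (4 * (real (Suc n))\<^sup>2)) + (cmod (b N))\<^sup>2 / (2 * real N)
      \<le> (\<Sum>n<N. (cmod (b (Suc n) - b n))\<^sup>2)"
  proof (induction N)
    case 0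
    show ?case by simp
  next
    case (Suc N)
    define x y where "x = cmod (b (Suc N))" and "y = cmod (b N)"
    have "x\<^sup>2 / (4 * (real (Suc N))\<^sup>2) + x\<^sup>2 / (2 * real (Suc N)) - y\<^sup>2 / (2 * real N)
        \<le> (cmod (b (Suc N) - b N))\<^sup>2"
    proof (cases "N = 0")
      case True
      then have "b N = 0" by (simp add: b0)
      then show ?thesis using True by (simp add: x_def y_def)
    next
      case False
      define r where "r = real N"
      have r: "r > 0" using False by (simp add: r_def)
      have "x\<^sup>2 / (4 * (r + 1)\<^sup>2) + x\<^sup>2 / (2 * (r + 1)) \<le> x\<^sup>2 / (2 * r + 1)"
      proof -
        have "1 / (4 * (r + 1)\<^sup>2) + 1 / (2 * (r + 1)) \<le> 1 / (2 * r + 1)"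
          using r by (simp add: divide_simps power2_eq_square) (simp add: algebra_simps)
        then have "x\<^sup>2 * (1 / (4 * (r + 1)\<^sup>2) + 1 / (2 * (r + 1))) \<le> x\<^sup>2 * (1 / (2 * r + 1))"
          by (rule mult_left_mono) simp
        then show ?thesis by (simp add: distrib_left)
      qed
      also have "x\<^sup>2 / (2 * r + 1) \<le> (x - y)\<^sup>2 + y\<^sup>2 / (2 * r)"
      proof -
        \<comment> \<open>completing the square in \<open>y\<close>, whose minimizer is \<open>2 * r * x / (2 * r + 1)\<close>\<close>
        have "(x - y)\<^sup>2 + y\<^sup>2 / (2 * r) - x\<^sup>2 / (2 * r + 1)
            = (2 * r * x - (2 * r + 1) * y)\<^sup>2 / (2 * r * (2 * r + 1))"
          using r by (simp add: divide_simps power2_eq_square) (simp add: algebra_simps)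
        also have "\<dots> \<ge> 0" using r by simp
        finally show ?thesis by simp
      qed
      also have "(x - y)\<^sup>2 \<le> (cmod (b (Suc N) - b N))\<^sup>2"
        unfolding x_def y_def using norm_triangle_ineq3[of "b (Suc N)" "b N"]
        by (simp add: abs_le_square_iff[symmetric])
      finally show ?thesis by (simp add: r_def algebra_simps)
    qed
    then show ?case using Suc.IH by (simp add: x_def y_def)
  qed
  moreover have "(cmod (b N))\<^sup>2 / (2 * real N) \<ge> 0" by simp
  ultimately have "(\<Sum>n<N. (cmod (b (Suc n)))\<^sup>2 / (4 * (real (Suc n))\<^sup>2)) \<le> (\<Sum>n<N. (cmod (b (Suc n) - b n))\<^sup>2)"
    by linarith
  moreover have "(\<Sum>n<N. (cmod (b (Suc n)))\<^sup>2 / (real (Suc n))\<^sup>2)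
      = 4 * (\<Sum>n<N. (cmod (b (Suc n)))\<^sup>2 / (4 * (real (Suc n))\<^sup>2))"
    by (simp add: sum_distrib_left)
  ultimately show ?thesis by simp
qed

lemma norm_one_minus_character: "(cmod (1 - character 1 t))\<^sup>2 = 2 * (1 - cos t)"
proof -
  have "(cmod (1 - character 1 t))\<^sup>2 = (1 - cos t)\<^sup>2 + (sin t)\<^sup>2"
    by (simp add: character_def cmod_power2)
  also have "\<dots> = 1 - 2 * cos t + ((sin t)\<^sup>2 + (cos t)\<^sup>2)"
    by (simp add: power2_eq_square algebra_simps del: sin_cos_squared_add3)
  finally show ?thesis by (simp only: sin_cos_squared_add) simp
qed

text \<open>
  The weight is absorbed into the function, where it becomes a difference operator on the Fourier
  coefficients.
\<close>

lemma weighted_integral: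
  "integral\<^sup>L circle (\<lambda>t. (1 - cos t) * (cmod (g t))\<^sup>2)
    = integral\<^sup>L circle (\<lambda>t. (cmod ((1 - character 1 t) * g t))\<^sup>2) / 2"
  by (simp add: norm_mult power_mult_distrib norm_one_minus_character mult.assoc del: right_diff_distrib_numeral)

lemma square_integrable_shift:
  assumes "square_integrable g"
  shows "square_integrable (\<lambda>t. (1 - character 1 t) * g t)"
proof (rule square_integrable_mult_bounded[OF assms])
  show "cmod (1 - character 1 t) \<le> 2" for t
    using norm_triangle_ineq4[of 1 "character 1 t"] by simp
qed measurable

lemma fourier_coeff_shift:
  assumes "square_integrable g"
  shows "fourier_coeff (\<lambda>t. (1 - character 1 t) * g t) n = fourier_coeff g n - fourier_coeff g (n - 1)"
proof -
  have "character 1 t * character (- n) t = character (- (n - 1)) t" for t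
    by (simp add: character_mult)
  then have "(1 - character 1 t) * g t * character (- n) t
      = g t * character (- n) t - g t * character (- (n - 1)) t" for t
    by (metis (no_types, lifting) left_diff_distrib mult.assoc mult.commute mult_1)
  then have "2 * pi * fourier_coeff (\<lambda>t. (1 - character 1 t) * g t) n
      = integral\<^sup>L circle (\<lambda>t. g t * character (- n) t - g t * character (- (n - 1)) t)"
    by (simp only: fourier_coeff_character[symmetric])
  also have "\<dots> = 2 * pi * fourier_coeff g n - 2 * pi * fourier_coeff g (n - 1)"
    by (subst Bochner_Integration.integral_diff)
       (simp_all only: integrable_mult_character[OF assms] fourier_coeff_character)
  finally show ?thesis by (simp add: right_diff_distrib[symmetric])
qed

lemma sum_symmetric_int:
  fixes h :: "int \<Rightarrow> real"
  assumes "h 0 = 0"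
  shows "(\<Sum>n\<in>{- int N..int N}. h n) = (\<Sum>n<N. h (int (Suc n))) + (\<Sum>n<N. h (- int (Suc n)))"
proof (induction N)
  case 0
  then show ?case by (simp add: assms)
next
  case (Suc N)
  have "{- int (Suc N)..int (Suc N)} = insert (int (Suc N)) (insert (- int (Suc N)) {- int N..int N})"
    by auto
  then show ?case using Suc by simp
qed

text \<open>
  Bessel's inequality for \<open>(1 - character 1 t) * g t\<close>: the coefficients at the frequencies \<open>1, \<dots>, N\<close>
  give the first sum, those at \<open>0, -1, \<dots>, 1 - N\<close> the second one. Each sum is in the form of Hardy's
  inequality for a sequence starting at frequency \<open>0\<close>.
\<close>

lemma sum_differences_le_weighted_integral:
  assumes g: "square_integrable g"
  defines "b \<equiv> fourier_coeff g"
  shows "pi * ((\<Sum>n<N. (cmod (b (int (Suc n)) - b (int n)))\<^sup>2)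
             + (\<Sum>n<N. (cmod (b (- int (Suc n)) - b (- int n)))\<^sup>2))
    \<le> integral\<^sup>L circle (\<lambda>t. (1 - cos t) * (cmod (g t))\<^sup>2)"
proof -
  let ?d = "\<lambda>n. (cmod (b n - b (n - 1)))\<^sup>2"
  let ?P = "(\<lambda>n. int (Suc n)) ` {..<N}" and ?M = "(\<lambda>n. - int n) ` {..<N}"
  have "(\<Sum>n\<in>?P. ?d n) = (\<Sum>n<N. (cmod (b (int (Suc n)) - b (int n)))\<^sup>2)"
    by (subst sum.reindex) (auto simp: inj_on_def)
  moreover have "(\<Sum>n\<in>?M. ?d n) = (\<Sum>n<N. (cmod (b (- int (Suc n)) - b (- int n)))\<^sup>2)"
  proof -
    have "?d (- int n) = (cmod (b (- int (Suc n)) - b (- int n)))\<^sup>2" for n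
    proof -
      have "- int n - 1 = - int (Suc n)" by simp
      then show ?thesis by (simp only: norm_minus_commute)
    qed
    then show ?thesis by (subst sum.reindex) (auto simp: inj_on_def simp del: of_nat_Suc)
  qed
  moreover have "(\<Sum>n\<in>?P \<union> ?M. ?d n) = (\<Sum>n\<in>?P. ?d n) + (\<Sum>n\<in>?M. ?d n)"
    by (intro sum.union_disjoint) auto
  moreover have "2 * pi * (\<Sum>n\<in>?P \<union> ?M. ?d n)
      \<le> 2 * integral\<^sup>L circle (\<lambda>t. (1 - cos t) * (cmod (g t))\<^sup>2)"
    using bessel_inequality[OF square_integrable_shift[OF g], of "?P \<union> ?M"]
    by (simp add: fourier_coeff_shift[OF g] b_def weighted_integral)
  ultimately show ?thesis by simp
qed

lemma admissible_iff:
  "admissible f f' \<longleftrightarrow> L2_circle f \<and> L2_circle f' \<and> has_circle_deriv f f' \<and> fourier_coeff f 0 = 0"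
  by (auto simp: admissible_def fourier_coeff_def)

lemma L2_circle_imp_square_integrable:
  "L2_circle f \<Longrightarrow> square_integrable f"
  by (auto simp: L2_circle_def square_integrable_def circle_integrable intro: measurable_restrict_space1)

text \<open>
  The two halves of the spectrum do not interact: \<open>b 0 = 0\<close> is the starting value that Hardy's
  inequality requires both for \<open>b n\<close> and for \<open>b (- n)\<close>.
\<close>

theorem weighted_wirtinger_inequality:
  assumes "admissible f f'"
  shows "integral\<^sup>L circle (\<lambda>t. (cmod (f t))\<^sup>2) \<le> 8 * integral\<^sup>L circle (\<lambda>t. (1 - cos t) * (cmod (f' t))\<^sup>2)"
    (is "_ \<le> 8 * ?I")
proof (rule norm_le_of_fourier_coeff_sums_le)
  show "square_integrable f"
    using assms by (simp add: admissible_def L2_circle_imp_square_integrable)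
  fix A :: "int set" assume A: "finite A"
  define a b where "a = fourier_coeff f" and "b = fourier_coeff f'"
  have a0: "a 0 = 0" and b: "b n = \<i> * of_int n * a n" for n
    using assms by (auto simp: admissible_iff has_circle_deriv_def a_def b_def)
  have norm_a: "(cmod (a n))\<^sup>2 = (cmod (b n))\<^sup>2 / (of_int n)\<^sup>2" for n
    using a0 by (cases "n = 0") (simp_all add: b norm_mult power_mult_distrib)
  define N where "N = nat (Max (insert 0 (abs ` A)))"
  have "A \<subseteq> {- int N..int N}"
  proof
    fix n assume "n \<in> A"
    then have "\<bar>n\<bar> \<le> Max (insert 0 (abs ` A))" using A by (intro Max_ge) auto
    then show "n \<in> {- int N..int N}" unfolding N_def by auto
  qed
  then have "(\<Sum>n\<in>A. (cmod (a n))\<^sup>2) \<le> (\<Sum>n\<in>{- int N..int N}. (cmod (a n))\<^sup>2)"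
    by (intro sum_mono2) auto
  also have "\<dots> = (\<Sum>n<N. (cmod (b (int (Suc n))))\<^sup>2 / (real (Suc n))\<^sup>2)
      + (\<Sum>n<N. (cmod (b (- int (Suc n))))\<^sup>2 / (real (Suc n))\<^sup>2)"
  proof -
    have "(of_int (int (Suc n)) :: real)\<^sup>2 = (real (Suc n))\<^sup>2"
      "(of_int (- int (Suc n)) :: real)\<^sup>2 = (real (Suc n))\<^sup>2" for n
      by (simp_all add: power2_eq_square algebra_simps)
    then show ?thesis
      using a0 by (subst sum_symmetric_int) (simp, simp only: norm_a)
  qed
  also have "\<dots> \<le> 4 * (\<Sum>n<N. (cmod (b (int (Suc n)) - b (int n)))\<^sup>2)
      + 4 * (\<Sum>n<N. (cmod (b (- int (Suc n)) - b (- int n)))\<^sup>2)"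
    using discrete_hardy[of "\<lambda>n. b (int n)" N] discrete_hardy[of "\<lambda>n. b (- int n)" N]
    by (intro add_mono) (simp_all only: b of_nat_0 of_int_0 minus_zero mult_zero_right mult_zero_left)
  finally have "2 * pi * (\<Sum>n\<in>A. (cmod (a n))\<^sup>2)
      \<le> 2 * pi * (4 * (\<Sum>n<N. (cmod (b (int (Suc n)) - b (int n)))\<^sup>2)
      + 4 * (\<Sum>n<N. (cmod (b (- int (Suc n)) - b (- int n)))\<^sup>2))"
    by (intro mult_left_mono) auto
  also have "\<dots> \<le> 8 * ?I"
    using sum_differences_le_weighted_integral[OF L2_circle_imp_square_integrable, of f' N] assms
    by (simp add: admissible_def b_def algebra_simps)
  finally show "2 * pi * (\<Sum>n\<in>A. (cmod (fourier_coeff f n))\<^sup>2) \<le> 8 * ?I"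
    by (simp add: a_def)
qed

lemma admissible_trig_sum:
  assumes "finite A" "0 \<notin> A"
  shows "admissible (trig_sum A c) (trig_sum A (\<lambda>n. \<i> * of_int n * c n))"
proof -
  have "L2_circle (trig_sum A d)" for d
  proof -
    have "character n (t + 2 * pi) = character n t * cis (2 * pi * of_int n)" for n t
      by (simp add: character_def cis_mult distrib_left mult.commute)
    then have "character n (t + 2 * pi) = character n t" for n t
      by simp
    then have "periodic_fun_simple (trig_sum A d) (2 * pi)"
      by unfold_locales (simp add: trig_sum_def)
    moreover have "trig_sum A d \<in> borel_measurable lebesgue"
    proof -
      have "trig_sum A d \<in> borel_measurable borel"
        by (intro borel_measurable_continuous_onI continuous_trig_sum)
      then show ?thesis by (intro measurable_completion) simp
    qed
    moreover have "set_integrable lebesgue {0..2 * pi} (\<lambda>t. (cmod (trig_sum A d t))\<^sup>2)"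
      using square_integrable_trig_sum by (simp add: circle_integrable square_integrable_def)
    ultimately show ?thesis by (simp add: L2_circle_def)
  qed
  then show ?thesis
    using assms by (simp add: admissible_iff has_circle_deriv_def fourier_coeff_trig_sum)
qed

text \<open>
  Summation by parts, with the boundary term at the top frequency.
\<close>

lemma one_minus_character_mult_sum:
  fixes b :: "nat \<Rightarrow> complex"
  assumes "b 0 = 0"
  shows "(1 - character 1 t) * (\<Sum>n<N. b (Suc n) * character (int (Suc n)) t)
    = (\<Sum>n<N. (b (Suc n) - b n) * character (int (Suc n)) t) - b N * character (int (Suc N)) t"
proof (induction N)
  case 0
  then show ?case by (simp add: assms)
next
  case (Suc N)
  let ?S = "\<Sum>n<N. b (Suc n) * character (int (Suc n)) t"
  let ?x = "b (Suc N) * character (int (Suc N)) t"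
  have "character 1 t * ?x = b (Suc N) * character (int (Suc (Suc N))) t"
    by (simp add: character_mult mult.left_commute)
  moreover have "(1 - character 1 t) * (?S + ?x) = (1 - character 1 t) * ?S + (?x - character 1 t * ?x)"
    by (simp only: distrib_left left_diff_distrib mult_1)
  ultimately show ?case
    unfolding sum.lessThan_Suc Suc by (simp only: left_diff_distrib) simp
qed

text \<open>
  For a finite sequence vanishing at both ends the energy is an exact sum, since no frequency is lost
  in Bessel's inequality.
\<close>

lemma weighted_integral_eq_differences:
  fixes b :: "nat \<Rightarrow> complex"
  assumes "b 0 = 0" "b N = 0"
  shows "integral\<^sup>L circle (\<lambda>t. (1 - cos t) * (cmod (trig_sum {1..int N} (\<lambda>n. b (nat n)) t))\<^sup>2)
    = pi * (\<Sum>n<N. (cmod (b (Suc n) - b n))\<^sup>2)"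
proof -
  have reindex: "(\<Sum>n\<in>{1..int N}. h n) = (\<Sum>n<N. h (int (Suc n)))" for h :: "int \<Rightarrow> 'a::comm_monoid_add"
    by (rule sum.reindex_bij_witness[of _ "\<lambda>n. int (Suc n)" "\<lambda>n. nat (n - 1)"]) auto
  have pred: "nat (int (Suc n) - 1) = n" for n by simp
  have "(1 - character 1 t) * trig_sum {1..int N} (\<lambda>n. b (nat n)) t
      = trig_sum {1..int N} (\<lambda>n. b (nat n) - b (nat (n - 1))) t" for t
    using one_minus_character_mult_sum[of b t N] assms
    unfolding trig_sum_def reindex by (simp add: pred del: of_nat_Suc)
  then show ?thesis
    unfolding weighted_integral by (simp add: norm_trig_sum reindex pred del: of_nat_Suc)
qed

section \<open>Sharpness of the constant\<close>

text \<open>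
  The sequence \<open>\<surd>n\<close> is the extremal that Hardy's inequality lacks, its two sums being divergent. It is
  cut off by a linear descent that reaches \<open>0\<close> at \<open>2 * N\<close> and costs only \<open>N * (\<surd>N / N)\<^sup>2 = 1\<close> in squared
  differences.
\<close>

definition hardy_profile :: "nat \<Rightarrow> nat \<Rightarrow> real" where
  "hardy_profile N n = (if n \<le> N then sqrt n else sqrt N * (2 - n / N))"

text \<open>
  Each difference is at most \<open>1 / (2 \<surd>n)\<close>, so its square is at most \<open>1 / (4 n)\<close>; the summand \<open>n = 0\<close>
  contributes the \<open>1\<close>.
\<close>

lemma sum_sqrt_differences_le:
  "(\<Sum>n<Suc N. (sqrt (Suc n) - sqrt n)\<^sup>2) \<le> 1 + harm N / 4"
proof (induction N)
  case 0
  show ?case by (simp add: harm_def)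
next
  case (Suc N)
  define r where "r = real (Suc N)"
  have r: "r > 0" by (simp add: r_def)
  have "sqrt (r + 1) - sqrt r \<le> 1 / (2 * sqrt r)"
  proof -
    have "(sqrt (r + 1) - sqrt r) * (2 * sqrt r) \<le> (sqrt (r + 1) - sqrt r) * (sqrt (r + 1) + sqrt r)"
      using r by (intro mult_left_mono) auto
    also have "\<dots> = 1" using r by (simp add: algebra_simps)
    finally show ?thesis using r by (simp add: field_simps)
  qed
  then have "(sqrt (r + 1) - sqrt r)\<^sup>2 \<le> (1 / (2 * sqrt r))\<^sup>2"
    using r by (intro power_mono) auto
  also have "\<dots> = inverse r / 4"
    using r by (simp add: power_divide power_mult_distrib field_simps)
  finally have "(sqrt (Suc (Suc N)) - sqrt (Suc N))\<^sup>2 \<le> inverse (real (Suc N)) / 4"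
    by (simp add: r_def algebra_simps)
  then show ?case
    using Suc by (simp add: harm_Suc add_divide_distrib del: of_nat_Suc)
qed

lemma hardy_profile_differences_le:
  assumes "N > 0"
  shows "(\<Sum>n<2 * N. (hardy_profile N (Suc n) - hardy_profile N n)\<^sup>2) \<le> 2 + harm N / 4"
proof -
  let ?d = "\<lambda>n. (hardy_profile N (Suc n) - hardy_profile N n)\<^sup>2"
  obtain M where M: "N = Suc M" using assms by (cases N) auto
  have "{..<2 * N} = {..<N} \<union> {N..<2 * N}" by auto
  then have "(\<Sum>n<2 * N. ?d n) = (\<Sum>n<N. ?d n) + (\<Sum>n\<in>{N..<2 * N}. ?d n)"
    by (simp add: sum.union_disjoint ivl_disj_int)
  also have "(\<Sum>n<N. ?d n) = (\<Sum>n<N. (sqrt (Suc n) - sqrt n)\<^sup>2)"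
    by (intro sum.cong) (auto simp: hardy_profile_def)
  also have "\<dots> \<le> 1 + harm N / 4"
    using sum_sqrt_differences_le[of M] harm_mono[of M N, where 'a=real] by (simp add: M)
  also have "(\<Sum>n\<in>{N..<2 * N}. ?d n) = (\<Sum>n\<in>{N..<2 * N}. 1 / N)"
  proof (intro sum.cong refl)
    fix n assume "n \<in> {N..<2 * N}"
    then have "hardy_profile N n = sqrt N * (2 - n / N)" "hardy_profile N (Suc n) = sqrt N * (2 - Suc n / N)"
      using assms by (auto simp: hardy_profile_def)
    then have "hardy_profile N (Suc n) - hardy_profile N n = - (sqrt N / N)"
      using assms by (simp add: field_simps)
    then show "?d n = 1 / N" using assms by (simp add: power_divide power2_eq_square)
  qed
  also have "\<dots> = 1" using assms by simp
  finally show ?thesis by simp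
qed

lemma harm_le_sum_hardy_profile:
  assumes "N > 0"
  shows "harm N \<le> (\<Sum>n<2 * N. (hardy_profile N (Suc n))\<^sup>2 / (real (Suc n))\<^sup>2)"
proof -
  have "harm N = (\<Sum>n<N. inverse (real (Suc n)))"
    unfolding harm_def by (rule sum.reindex_bij_witness[of _ Suc "\<lambda>n. n - 1"]) auto
  also have "\<dots> = (\<Sum>n<N. (hardy_profile N (Suc n))\<^sup>2 / (real (Suc n))\<^sup>2)"
  proof (intro sum.cong refl)
    fix n assume "n \<in> {..<N}"
    then have "(hardy_profile N (Suc n))\<^sup>2 = real (Suc n)"
      by (simp add: hardy_profile_def)
    then show "inverse (real (Suc n)) = (hardy_profile N (Suc n))\<^sup>2 / (real (Suc n))\<^sup>2"
      by (simp only: power2_eq_square) (simp add: divide_simps)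
  qed
  also have "\<dots> \<le> (\<Sum>n<2 * N. (hardy_profile N (Suc n))\<^sup>2 / (real (Suc n))\<^sup>2)"
    by (intro sum_mono2) auto
  finally show ?thesis .
qed

text \<open>
  With the profile of length \<open>N\<close> the energy is at most \<open>\<pi> (2 + H\<^sub>N / 4)\<close> and the squared norm is at least
  \<open>2 \<pi> H\<^sub>N\<close>, so it suffices that \<open>H\<^sub>N\<close> exceeds \<open>2 / (2 C - 1 / 4)\<close>.
\<close>

lemma exists_admissible_below:
  assumes C: "C > 1 / 8"
  obtains f f' where "admissible f f'"
    "integral\<^sup>L circle (\<lambda>t. (1 - cos t) * (cmod (f' t))\<^sup>2) < C * integral\<^sup>L circle (\<lambda>t. (cmod (f t))\<^sup>2)"
proof -
  have "\<forall>\<^sub>F N in sequentially. harm N > 2 / (2 * C - 1 / 4)"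
    using harm_at_top by (simp add: filterlim_at_top_dense)
  with eventually_gt_at_top[of 0] have "\<forall>\<^sub>F N in sequentially. N > 0 \<and> harm N > 2 / (2 * C - 1 / 4)"
    by eventually_elim simp
  then obtain N :: nat where N: "N > 0" and harm: "harm N > 2 / (2 * C - 1 / 4)"
    by (auto simp: eventually_sequentially)
  define A where "A = {1..int (2 * N)}"
  define b where "b n = complex_of_real (hardy_profile N n)" for n
  \<comment> \<open>\<open>b\<close> is prescribed for the derivative, so \<open>f\<close> itself has the coefficients \<open>b n / (i n)\<close>\<close>
  define c where "c n = b (nat n) / (\<i> * of_int n)" for n
  define f f' where "f = trig_sum A c" and "f' = trig_sum A (\<lambda>n. \<i> * of_int n * c n)"
  have admissible: "admissible f f'"
    unfolding f_def f'_def by (rule admissible_trig_sum) (auto simp: A_def)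
  have "f' = trig_sum A (\<lambda>n. b (nat n))"
    unfolding f'_def trig_sum_def[abs_def] by (intro ext sum.cong) (auto simp: A_def c_def)
  then have "integral\<^sup>L circle (\<lambda>t. (1 - cos t) * (cmod (f' t))\<^sup>2)
      = pi * (\<Sum>n<2 * N. (cmod (b (Suc n) - b n))\<^sup>2)"
    unfolding A_def
    using N by (simp only:) (rule weighted_integral_eq_differences, auto simp: b_def hardy_profile_def)
  then have energy: "integral\<^sup>L circle (\<lambda>t. (1 - cos t) * (cmod (f' t))\<^sup>2) \<le> pi * (2 + harm N / 4)"
    using hardy_profile_differences_le[OF N] by (simp add: b_def flip: of_real_diff)
  have "integral\<^sup>L circle (\<lambda>t. (cmod (f t))\<^sup>2) = 2 * pi * (\<Sum>n\<in>A. (cmod (c n))\<^sup>2)"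
    unfolding f_def by (rule norm_trig_sum) (simp add: A_def)
  also have "(\<Sum>n\<in>A. (cmod (c n))\<^sup>2) = (\<Sum>n<2 * N. (hardy_profile N (Suc n))\<^sup>2 / (real (Suc n))\<^sup>2)"
    unfolding A_def
    by (rule sum.reindex_bij_witness[of _ "\<lambda>n. int (Suc n)" "\<lambda>n. nat (n - 1)"])
       (auto simp: c_def b_def norm_divide norm_mult power_divide nat_diff_distrib)
  finally have mass: "integral\<^sup>L circle (\<lambda>t. (cmod (f t))\<^sup>2) \<ge> 2 * pi * harm N"
    using harm_le_sum_hardy_profile[OF N] by simp
  have "2 + harm N / 4 < 2 * C * harm N"
    using harm C by (simp add: field_simps)
  then have "pi * (2 + harm N / 4) < pi * (2 * C * harm N)"
    by (intro mult_strict_left_mono) auto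
  also have "\<dots> = C * (2 * pi * harm N)" by simp
  also have "\<dots> \<le> C * integral\<^sup>L circle (\<lambda>t. (cmod (f t))\<^sup>2)"
    using mass C by (intro mult_left_mono) auto
  finally show ?thesis using energy that[OF admissible] by (meson le_less_trans)
qed

theorem theorem3p2:
  "(\<forall>f f' :: real \<Rightarrow> complex. admissible f f' \<longrightarrow>
      (LINT \<theta>:{0..2 * pi}|lebesgue. (1 - cos \<theta>) * (cmod (f' \<theta>))\<^sup>2)
        \<ge> 1 / 8 * (LINT \<theta>:{0..2 * pi}|lebesgue. (cmod (f \<theta>))\<^sup>2))
   \<and> (\<forall>C :: real. C > 1 / 8 \<longrightarrow>
      (\<exists>f f' :: real \<Rightarrow> complex. admissible f f' \<and>
        \<not> (LINT \<theta>:{0..2 * pi}|lebesgue. (1 - cos \<theta>) * (cmod (f' \<theta>))\<^sup>2)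
            \<ge> C * (LINT \<theta>:{0..2 * pi}|lebesgue. (cmod (f \<theta>))\<^sup>2)))"
proof (intro conjI allI impI)
  fix f f' :: "real \<Rightarrow> complex"
  assume "admissible f f'"
  then show "(LINT \<theta>:{0..2 * pi}|lebesgue. (1 - cos \<theta>) * (cmod (f' \<theta>))\<^sup>2)
      \<ge> 1 / 8 * (LINT \<theta>:{0..2 * pi}|lebesgue. (cmod (f \<theta>))\<^sup>2)"
    using weighted_wirtinger_inequality unfolding circle_integral by fastforce
next
  fix C :: real
  assume "C > 1 / 8"
  then show "\<exists>f f' :: real \<Rightarrow> complex. admissible f f' \<and>
        \<not> (LINT \<theta>:{0..2 * pi}|lebesgue. (1 - cos \<theta>) * (cmod (f' \<theta>))\<^sup>2)
            \<ge> C * (LINT \<theta>:{0..2 * pi}|lebesgue. (cmod (f \<theta>))\<^sup>2)"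
    unfolding circle_integral not_le by (elim exists_admissible_below) blast
qed

end
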